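(* Let $(X,\mu)$ be a measure space with $\mu$ non-trivial, $\sigma$-finite and positive, let $\mathcal{H}$ be a separable Hilbert space, and let $(\Psi,\Phi)$ be a reproducing pair for $\mathcal{H}$, with $\Psi,\Phi:X\to\mathcal{H}$. Then the space $\mathcal{H}_K^\Phi:=\operatorname{Ran}C_\Psi$, consisting of the functions $C_\Psi f:X\to\mathbb{C}$, $C_\Psi f(x)=\langle f,\Psi_x\rangle$, $f\in\mathcal{H}$, equipped with the inner product $\langle F,G\rangle_\Phi:=\langle T_\Phi F,T_\Phi G\rangle$, is a reproducing kernel Hilbert space of functions on $X$, and its reproducing kernel is $$K_\Phi(x,y)=\big\langle S_{\Phi,\Psi}^{-1}\Psi_x,\;S_{\Phi,\Psi}^{-1}\Psi_y\big\rangle,\qquad x,y\in X,$$ in the sense that for every $x\in X$ the function $K_\Phi(x,\cdot)$ belongs to $\mathcal{H}_K^\Phi$ and $F(x)=\langle F,K_\Phi(x,\cdot)\rangle_\Phi$ for all $F\in\mathcal{H}_K^\Phi$.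
   Context: Inner products are linear in the first argument. Let $\Psi,\Phi:X\to\mathcal{H}$ be weakly measurable, i.e. $x\mapsto\langle f,\Psi_x\rangle$ and $x\mapsto\langle f,\Phi_x\rangle$ are measurable for all $f\in\mathcal{H}$. The pair $(\Psi,\Phi)$ is a reproducing pair for $\mathcal{H}$ if the operator $S_{\Psi,\Phi}$ defined weakly by $\langle S_{\Psi,\Phi}f,g\rangle:=\int_X\langle f,\Psi_x\rangle\langle\Phi_x,g\rangle\,d\mu(x)$, $f,g\in\mathcal{H}$, is bounded on $\mathcal{H}$ with bounded inverse; $S_{\Phi,\Psi}$ is defined by exchanging the roles of $\Psi$ and $\Phi$, and $S_{\Phi,\Psi}=S_{\Psi,\Phi}^*$. $\mathcal{V}_\Phi(X,\mu)$ is the space of all measurable $F:X\to\mathbb{C}$ for which there is $M>0$ such that $\left|\int_XF(x)\langle\Phi_x,g\rangle\,d\mu(x)\right|\le M\|g\|$ for all $g\in\mathcal{H}$. The linear map $T_\Phi:\mathcal{V}_\Phi(X,\mu)\to\mathcal{H}$ is given weakly by $\langle T_\Phi F,g\rangle=\int_XF(x)\langle\Phi_x,g\rangle\,d\mu(x)$. For a reproducing pair, $\operatorname{Ran}C_\Psi\subset\mathcal{V}_\Phi(X,\mu)$ and $T_\Phi C_\Psi=S_{\Psi,\Phi}$. A Hilbert space of functions on $X$ is a reproducing kernel Hilbert space if point evaluation at every $x\in X$ is bounded. *)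

theory Defs
  imports "HOL-Analysis.Analysis"
begin

class complex_inner = real_normed_vector +
  fixes scaleC :: "complex \<Rightarrow> 'a \<Rightarrow> 'a"  (infixr \<open>*\<^sub>C\<close> 75)
    and cinner :: "'a \<Rightarrow> 'a \<Rightarrow> complex"
  assumes scaleC_add_right: "a *\<^sub>C (x + y) = a *\<^sub>C x + a *\<^sub>C y"
    and scaleC_add_left: "(a + b) *\<^sub>C x = a *\<^sub>C x + b *\<^sub>C x"
    and scaleC_scaleC: "a *\<^sub>C (b *\<^sub>C x) = (a * b) *\<^sub>C x"
    and scaleC_of_real: "complex_of_real r *\<^sub>C x = r *\<^sub>R x"
    and cinner_commute: "cinner x y = cnj (cinner y x)"
    and cinner_add_left: "cinner (x + y) z = cinner x z + cinner y z"
    and cinner_scaleC_left: "cinner (a *\<^sub>C x) y = a * cinner x y"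
    and cinner_nonneg: "0 \<le> Re (cinner x x)"
    and cinner_eq_zero_iff: "cinner x x = 0 \<longleftrightarrow> x = 0"
    and norm_eq_sqrt_cinner: "norm x = sqrt (Re (cinner x x))"

class chilbert_space = complex_inner + complete_space

definition bounded_clinear :: "('a::complex_inner \<Rightarrow> 'b::complex_inner) \<Rightarrow> bool" where
  "bounded_clinear T \<longleftrightarrow> bounded_linear T \<and> (\<forall>c f. T (c *\<^sub>C f) = c *\<^sub>C T f)"

text \<open>The set \<open>X\<close> is \<open>space M\<close>. Complex functions on \<open>X\<close> are functions on the whole type that
  vanish outside \<open>space M\<close>, so that pointwise operations stay within this representation.\<close>

definition weakly_measurable :: "'x measure \<Rightarrow> ('x \<Rightarrow> 'h::complex_inner) \<Rightarrow> bool" where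
  "weakly_measurable M \<Psi> \<longleftrightarrow> (\<forall>f. (\<lambda>x. cinner f (\<Psi> x)) \<in> borel_measurable M)"

definition frame_op ::
    "'x measure \<Rightarrow> ('x \<Rightarrow> 'h) \<Rightarrow> ('x \<Rightarrow> 'h) \<Rightarrow> 'h \<Rightarrow> 'h::complex_inner" where
  "frame_op M \<Psi> \<Phi> f =
    (THE h. \<forall>g. cinner h g = (LINT x|M. cinner f (\<Psi> x) * cinner (\<Phi> x) g))"

text \<open>The first two conditions after weak measurability say that the weak definition of the
  operator makes sense: the Bochner integral of a non-integrable function is \<open>0\<close> and a definite
  description may fail to denote.\<close>

definition reproducing_pair ::
    "'x measure \<Rightarrow> ('x \<Rightarrow> 'h::complex_inner) \<Rightarrow> ('x \<Rightarrow> 'h) \<Rightarrow> bool" where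
  "reproducing_pair M \<Psi> \<Phi> \<longleftrightarrow>
     weakly_measurable M \<Psi> \<and> weakly_measurable M \<Phi> \<and>
     (\<forall>f g. integrable M (\<lambda>x. cinner f (\<Psi> x) * cinner (\<Phi> x) g)) \<and>
     (\<forall>f g. cinner (frame_op M \<Psi> \<Phi> f) g = (LINT x|M. cinner f (\<Psi> x) * cinner (\<Phi> x) g)) \<and>
     bounded_clinear (frame_op M \<Psi> \<Phi>) \<and>
     bij (frame_op M \<Psi> \<Phi>) \<and> bounded_clinear (inv (frame_op M \<Psi> \<Phi>))"

definition analysis_op ::
    "'x measure \<Rightarrow> ('x \<Rightarrow> 'h::complex_inner) \<Rightarrow> 'h \<Rightarrow> 'x \<Rightarrow> complex" where
  "analysis_op M \<Psi> f = (\<lambda>x. if x \<in> space M then cinner f (\<Psi> x) else 0)"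

definition synthesis_domain ::
    "'x measure \<Rightarrow> ('x \<Rightarrow> 'h::complex_inner) \<Rightarrow> ('x \<Rightarrow> complex) set" where
  "synthesis_domain M \<Phi> =
    {F \<in> borel_measurable M. (\<forall>x. x \<notin> space M \<longrightarrow> F x = 0) \<and>
       (\<forall>g. integrable M (\<lambda>x. F x * cinner (\<Phi> x) g)) \<and>
       (\<exists>B>0. \<forall>g. cmod (LINT x|M. F x * cinner (\<Phi> x) g) \<le> B * norm g)}"

definition synthesis_op ::
    "'x measure \<Rightarrow> ('x \<Rightarrow> 'h) \<Rightarrow> ('x \<Rightarrow> complex) \<Rightarrow> 'h::complex_inner" where
  "synthesis_op M \<Phi> =
    (\<lambda>F\<in>synthesis_domain M \<Phi>. THE h. \<forall>g. cinner h g = (LINT x|M. F x * cinner (\<Phi> x) g))"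

definition synthesis_inner ::
    "'x measure \<Rightarrow> ('x \<Rightarrow> 'h::complex_inner) \<Rightarrow> ('x \<Rightarrow> complex) \<Rightarrow> ('x \<Rightarrow> complex) \<Rightarrow> complex" where
  "synthesis_inner M \<Phi> F G = cinner (synthesis_op M \<Phi> F) (synthesis_op M \<Phi> G)"

definition pair_kernel ::
    "'x measure \<Rightarrow> ('x \<Rightarrow> 'h::complex_inner) \<Rightarrow> ('x \<Rightarrow> 'h) \<Rightarrow> 'x \<Rightarrow> 'x \<Rightarrow> complex" where
  "pair_kernel M \<Psi> \<Phi> x y =
    (if x \<in> space M \<and> y \<in> space M
     then cinner (inv (frame_op M \<Phi> \<Psi>) (\<Psi> x)) (inv (frame_op M \<Phi> \<Psi>) (\<Psi> y)) else 0)"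

locale function_hilbert_space =
  fixes X :: "'x set"
    and V :: "('x \<Rightarrow> complex) set"
    and ip :: "('x \<Rightarrow> complex) \<Rightarrow> ('x \<Rightarrow> complex) \<Rightarrow> complex"
  assumes zero_outside: "\<lbrakk>F \<in> V; x \<notin> X\<rbrakk> \<Longrightarrow> F x = 0"
    and zero_mem: "(\<lambda>_. 0) \<in> V"
    and add_mem: "\<lbrakk>F \<in> V; G \<in> V\<rbrakk> \<Longrightarrow> (\<lambda>x. F x + G x) \<in> V"
    and scale_mem: "F \<in> V \<Longrightarrow> (\<lambda>x. c * F x) \<in> V"
    and ip_add_left: "\<lbrakk>F \<in> V; G \<in> V; H \<in> V\<rbrakk> \<Longrightarrow> ip (\<lambda>x. F x + G x) H = ip F H + ip G H"
    and ip_scale_left: "\<lbrakk>F \<in> V; G \<in> V\<rbrakk> \<Longrightarrow> ip (\<lambda>x. c * F x) G = c * ip F G"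
    and ip_commute: "\<lbrakk>F \<in> V; G \<in> V\<rbrakk> \<Longrightarrow> ip F G = cnj (ip G F)"
    and ip_nonneg: "F \<in> V \<Longrightarrow> 0 \<le> Re (ip F F)"
    and ip_definite: "\<lbrakk>F \<in> V; ip F F = 0\<rbrakk> \<Longrightarrow> F = (\<lambda>_. 0)"
    and complete: "Metric_space.mcomplete V
      (\<lambda>F G. sqrt (Re (ip (\<lambda>x. F x - G x) (\<lambda>x. F x - G x))))"

locale reproducing_kernel_hilbert_space = function_hilbert_space +
  assumes bounded_evaluation:
    "x \<in> X \<Longrightarrow> \<exists>B. \<forall>F\<in>V. cmod (F x) \<le> B * sqrt (Re (ip F F))"

definition reproducing_kernel ::
    "'x set \<Rightarrow> ('x \<Rightarrow> complex) set \<Rightarrow> (('x \<Rightarrow> complex) \<Rightarrow> ('x \<Rightarrow> complex) \<Rightarrow> complex) \<Rightarrow>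
     ('x \<Rightarrow> 'x \<Rightarrow> complex) \<Rightarrow> bool" where
  "reproducing_kernel X V ip K \<longleftrightarrow> (\<forall>x\<in>X. K x \<in> V \<and> (\<forall>F\<in>V. F x = ip F (K x)))"

end

(* The map u \<mapsto> C_\<Psi> (S\<^sup>-\<^sup>1 u) is a linear bijection of the Hilbert space onto Ran C_\<Psi> with left
   inverse T_\<Phi>, hence a unitary, so Ran C_\<Psi> inherits completeness. The operators S_{\<Phi>,\<Psi>} and its
   inverse are the adjoints of S = S_{\<Psi>,\<Phi>} and S\<^sup>-\<^sup>1, which exist by the Riesz representation theorem.
   Since F(x) = <S\<^sup>-\<^sup>1 u, \<Psi>_x> = <u, (S\<^sup>-\<^sup>1)* \<Psi>_x> for F = C_\<Psi> (S\<^sup>-\<^sup>1 u), evaluation at x is represented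
   by C_\<Psi> (S\<^sup>-\<^sup>1 (S\<^sup>-\<^sup>1)* \<Psi>_x) = K_\<Phi>(x, .). *)

theory Submission
  imports Defs
begin

section \<open>Complex inner product spaces\<close>

lemma cinner_zero_left [simp]: "cinner 0 (y::'a::complex_inner) = 0"
  using cinner_add_left[of 0 0 y] by simp

lemma scaleC_minus_one: "(- 1) *\<^sub>C x = - (x::'a::complex_inner)"
  using scaleC_of_real[of "-1" x] by simp

lemma cinner_minus_left: "cinner (- x) (y::'a::complex_inner) = - cinner x y"
  using cinner_scaleC_left[of "-1" x y] by (simp add: scaleC_minus_one)

lemma cinner_diff_left: "cinner (x - y) (z::'a::complex_inner) = cinner x z - cinner y z"
  using cinner_add_left[of x "- y" z] by (simp add: cinner_minus_left)

lemma cinner_add_right: "cinner x (y + z) = cinner x y + cinner x (z::'a::complex_inner)"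
  by (metis cinner_add_left cinner_commute complex_cnj_add)

lemma cinner_zero_right [simp]: "cinner (x::'a::complex_inner) 0 = 0"
  using cinner_add_right[of x 0 0] by simp

lemma cinner_minus_right: "cinner x (- y) = - cinner x (y::'a::complex_inner)"
  by (metis cinner_minus_left cinner_commute complex_cnj_minus)

lemma cinner_diff_right: "cinner x (y - z) = cinner x y - cinner x (z::'a::complex_inner)"
  using cinner_add_right[of x y "- z"] by (simp add: cinner_minus_right)

lemma cinner_scaleC_right: "cinner x (a *\<^sub>C y) = cnj a * cinner x (y::'a::complex_inner)"
  by (metis cinner_scaleC_left cinner_commute complex_cnj_mult)

lemma cinner_scaleR_right: "cinner x (r *\<^sub>R y) = complex_of_real r * cinner x (y::'a::complex_inner)"
  using cinner_scaleC_right[of x "complex_of_real r" y] by (simp add: scaleC_of_real)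

text \<open>Nondegeneracy, tested at \<open>g = x - y\<close>. It gives uniqueness of weakly defined
  vectors, on which the definite descriptions depend.\<close>

lemma cinner_left_eqI:
  assumes "\<And>g. cinner x g = cinner (y::'a::complex_inner) g"
  shows "x = y"
  using assms[of "x - y"] cinner_diff_left[of x y "x - y"] cinner_eq_zero_iff[of "x - y"] by simp

lemma norm_sq_eq_cinner: "(norm x)\<^sup>2 = Re (cinner x (x::'a::complex_inner))"
  by (simp add: norm_eq_sqrt_cinner cinner_nonneg)

lemma Re_cinner_commute: "Re (cinner x y) = Re (cinner y (x::'a::complex_inner))"
  by (subst cinner_commute) simp

lemma norm_add_sq:
  "(norm (x + y))\<^sup>2 = (norm x)\<^sup>2 + 2 * Re (cinner x y) + (norm (y::'a::complex_inner))\<^sup>2"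
  using Re_cinner_commute[of x y]
  by (simp add: norm_sq_eq_cinner cinner_add_left cinner_add_right)

lemma parallelogram_law:
  "(norm (x + y))\<^sup>2 + (norm (x - y))\<^sup>2 = 2 * (norm x)\<^sup>2 + 2 * (norm (y::'a::complex_inner))\<^sup>2"
  using norm_add_sq[of x y] norm_add_sq[of x "- y"] by (simp add: cinner_minus_right)

text \<open>First-order condition at a minimum: a parabola through the origin that stays nonnegative
  has slope zero there.\<close>

lemma real_quadratic_nonneg_imp_linear_zero:
  fixes a b :: real
  assumes "\<And>t. 0 \<le> a * t + b * t\<^sup>2" "b \<ge> 0"
  shows "a = 0"
proof (rule ccontr)
  assume "a \<noteq> 0"
  \<comment> \<open>The \<open>+ 1\<close> keeps the denominator positive when
    \<open>b = 0\<close>.\<close>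
  have "a * (- a / (b + 1)) + b * (- a / (b + 1))\<^sup>2 = - (a / (b + 1))\<^sup>2"
    using \<open>b \<ge> 0\<close> by (simp add: divide_simps power2_eq_square) (simp add: algebra_simps)
  moreover have "(a / (b + 1))\<^sup>2 > 0"
    using \<open>a \<noteq> 0\<close> \<open>b \<ge> 0\<close> by simp
  ultimately show False using assms(1)[of "- a / (b + 1)"] by linarith
qed

text \<open>Cauchy-Schwarz: subtracting from \<open>x\<close> its component along \<open>y\<close>
  leaves a vector \<open>z\<close> orthogonal to \<open>y\<close>, whose squared norm is
  nonnegative.\<close>

lemma cmod_cinner_le: "cmod (cinner x y) \<le> norm x * norm (y::'a::complex_inner)"
proof (cases "y = 0")
  case False
  define c where "c = cinner x y"
  define N where "N = (norm y)\<^sup>2"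
  have N: "N > 0" using False by (simp add: N_def)
  have yy: "cinner y y = complex_of_real N"
    using cinner_commute[of y y] by (simp add: N_def norm_sq_eq_cinner complex_eq_iff)
  define z where "z = x - (c / N) *\<^sub>C y"
  have "cinner z y = 0"
    using N by (simp add: z_def cinner_diff_left cinner_scaleC_left yy c_def)
  then have "cinner z z = cinner z x"
    by (subst (2) z_def) (simp add: cinner_diff_right cinner_scaleC_right)
  also have "\<dots> = cinner x x - c / N * cnj c"
    by (simp add: z_def c_def cinner_diff_left cinner_scaleC_left cinner_commute[symmetric])
  also have "c / N * cnj c = complex_of_real ((cmod c)\<^sup>2 / N)"
    using complex_norm_square[of c] by simp
  finally have "(norm z)\<^sup>2 = (norm x)\<^sup>2 - (cmod c)\<^sup>2 / N"
    by (simp add: norm_sq_eq_cinner)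
  then have "(cmod c)\<^sup>2 / N \<le> (norm x)\<^sup>2"
    by (metis diff_ge_0_iff_ge zero_le_power2)
  then have "(cmod c)\<^sup>2 \<le> (norm x * norm y)\<^sup>2"
    using N by (simp add: divide_simps N_def power_mult_distrib)
  then show ?thesis
    unfolding c_def by (rule power2_le_imp_le) simp
qed simp

section \<open>Riesz representation\<close>

text \<open>The representing vector is found as a minimiser of the functional \<open>Q\<close>.
  Completeness supplies the minimiser, and the vanishing of the directional derivatives there is the
  representation of \<open>Re (l x)\<close>.\<close>

theorem riesz_representation:
  fixes l :: "'h::chilbert_space \<Rightarrow> complex"
  assumes add: "\<And>x y. l (x + y) = l x + l y"
    and scale: "\<And>c x. l (c *\<^sub>C x) = c * l x"
    and bound: "\<And>x. cmod (l x) \<le> B * norm x"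
  shows "\<exists>h. \<forall>x. l x = cinner x h"
proof -
  \<comment> \<open>If \<open>h\<close> represents \<open>l\<close>, then \<open>Q x\<close> equals
    the squared norm of \<open>x - h\<close> minus that of \<open>h\<close>, so \<open>h\<close> is
    the only possible minimiser.\<close>
  define Q where "Q x = (norm x)\<^sup>2 - 2 * Re (l x)" for x
  have scaleR: "l (r *\<^sub>R x) = r * l x" for r x
    using scale[of "complex_of_real r" x] by (simp add: scaleC_of_real)
  have diff: "l (x - y) = l x - l y" for x y
    using add[of "x - y" y] by simp
  have Q_ge: "Q x \<ge> - B\<^sup>2" for x
  proof -
    have "Re (l x) \<le> B * norm x" using complex_Re_le_cmod bound order_trans by blast
    moreover have "0 \<le> (norm x - B)\<^sup>2" by simp
    ultimately show ?thesis by (simp add: Q_def power2_eq_square algebra_simps)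
  qed
  define m where "m = (INF x. Q x)"
  have bdd: "bdd_below (range Q)" using Q_ge by (meson bdd_belowI2)
  have m_le: "m \<le> Q x" for x unfolding m_def using bdd by (simp add: cINF_lower)
  have "\<exists>x. Q x < m + 1 / real (Suc n)" for n
    using cINF_less_iff[of UNIV Q "m + 1 / real (Suc n)"] bdd by (auto simp: m_def)
  then obtain X where X: "\<And>n. Q (X n) < m + 1 / real (Suc n)" by metis
  (* The parallelogram law turns near-minimality of Q at x and y into closeness of x and y. *)
  have close: "(norm (x - y))\<^sup>2 \<le> 2 * (Q x - m) + 2 * (Q y - m)" for x y
  proof -
    have "4 * m \<le> 4 * Q ((1/2) *\<^sub>R (x + y))" using m_le by simp
    also have "Q ((1/2) *\<^sub>R (x + y)) = (norm (x + y))\<^sup>2 / 4 - Re (l x) - Re (l y)"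
    proof -
      have "(norm ((1/2) *\<^sub>R (x + y)))\<^sup>2 = (norm (x + y))\<^sup>2 / 4"
        unfolding norm_scaleR power_mult_distrib by (simp add: power2_eq_square)
      moreover have "Re (l ((1/2) *\<^sub>R (x + y))) = (Re (l x) + Re (l y)) / 2"
        unfolding scaleR add by simp
      ultimately show ?thesis by (simp add: Q_def)
    qed
    finally show ?thesis
      using parallelogram_law[of x y] by (simp add: Q_def)
  qed
  have "Cauchy X"
  proof (rule metric_CauchyI)
    fix e :: real assume e: "0 < e"
    \<comment> \<open>By \<open>close\<close>, two excesses over \<open>m\<close> below a quarter of
      the square of \<open>e\<close> bound the squared distance by the square of
      \<open>e\<close>.\<close>
    obtain N where N: "inverse (real (Suc N)) < e\<^sup>2 / 4"
      using reals_Archimedean[of "e\<^sup>2 / 4"] e by auto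
    have small: "Q (X n) - m < e\<^sup>2 / 4" if "n \<ge> N" for n
    proof -
      have "1 / real (Suc n) \<le> 1 / real (Suc N)" using that by (simp add: frac_le)
      then show ?thesis using X[of n] N by (simp add: inverse_eq_divide)
    qed
    have "dist (X i) (X j) < e" if "i \<ge> N" "j \<ge> N" for i j
    proof -
      have "(norm (X i - X j))\<^sup>2 < e\<^sup>2"
        using close[of "X i" "X j"] small[OF that(1)] small[OF that(2)] by simp
      then show ?thesis using e by (simp add: dist_norm power2_less_imp_less)
    qed
    then show "\<exists>N. \<forall>i\<ge>N. \<forall>j\<ge>N. dist (X i) (X j) < e" by blast
  qed
  then obtain h where h: "X \<longlonglongrightarrow> h" using Cauchy_convergent_iff convergent_def by blast
  have "bounded_linear l"
  proof (rule bounded_linear_intro)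
    show "l (x + y) = l x + l y" for x y by (rule add)
    show "l (r *\<^sub>R x) = r *\<^sub>R l x" for r x by (simp only: scaleR scaleR_conv_of_real)
    show "cmod (l x) \<le> norm x * B" for x by (metis bound mult.commute)
  qed
  then have "(\<lambda>n. l (X n)) \<longlonglongrightarrow> l h"
    using h by (rule bounded_linear.tendsto)
  then have "(\<lambda>n. Q (X n)) \<longlonglongrightarrow> Q h"
    unfolding Q_def by (intro tendsto_intros h)
  moreover have "(\<lambda>n. m + 1 / real (Suc n)) \<longlonglongrightarrow> m + 0"
    by (intro tendsto_intros LIMSEQ_Suc lim_1_over_n)
  ultimately have "Q h \<le> m + 0"
    by (rule LIMSEQ_le) (use X less_imp_le in blast)
  then have Qh: "Q h \<le> Q x" for x using m_le[of x] by simp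
  have Re_eq: "Re (l x) = Re (cinner x h)" for x
  proof -
    \<comment> \<open>The left side is the derivative of
      \<open>t \<mapsto> Q (h + t *\<^sub>R x)\<close> at \<open>t = 0\<close>.\<close>
    have "2 * Re (cinner h x) - 2 * Re (l x) = 0"
    proof (rule real_quadratic_nonneg_imp_linear_zero[where b="(norm x)\<^sup>2"])
      fix t :: real
      show "0 \<le> (2 * Re (cinner h x) - 2 * Re (l x)) * t + (norm x)\<^sup>2 * t\<^sup>2"
        using Qh[of "h + t *\<^sub>R x"]
        by (simp add: Q_def norm_add_sq add scaleR cinner_scaleR_right power_mult_distrib algebra_simps)
    qed simp
    then show ?thesis using Re_cinner_commute[of x h] by simp
  qed
  \<comment> \<open>Both sides are complex linear in \<open>x\<close>, and multiplication by
    \<open>\<i>\<close> turns the imaginary part into minus the real part.\<close>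
  have "Im (l x) = Im (cinner x h)" for x
    using Re_eq[of "\<i> *\<^sub>C x"] by (simp add: scale cinner_scaleC_left)
  then show ?thesis using Re_eq complex_eqI by blast
qed

text \<open>For each fixed \<open>g\<close>, Riesz representation applies to
  \<open>f \<mapsto> cinner (A f) g\<close>; choosing a representer for every \<open>g\<close> gives
  the adjoint.\<close>

lemma bounded_clinear_adjoint_exists:
  fixes A :: "'h::chilbert_space \<Rightarrow> 'h"
  assumes "bounded_clinear A"
  shows "\<exists>A'. \<forall>f g. cinner (A f) g = cinner f (A' g)"
proof -
  have A: "bounded_linear A" and Ac: "\<And>c f. A (c *\<^sub>C f) = c *\<^sub>C A f"
    using assms by (auto simp: bounded_clinear_def)
  obtain K where K: "\<And>x. norm (A x) \<le> norm x * K"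
    using A by (auto dest: bounded_linear.bounded)
  have "\<exists>h. \<forall>f. cinner (A f) g = cinner f h" for g
  proof (rule riesz_representation[where B="K * norm g"])
    fix x y c
    show "cinner (A (x + y)) g = cinner (A x) g + cinner (A y) g"
      by (simp add: linear_add bounded_linear.linear[OF A] cinner_add_left)
    show "cinner (A (c *\<^sub>C x)) g = c * cinner (A x) g"
      by (simp add: Ac cinner_scaleC_left)
    have "cmod (cinner (A x) g) \<le> norm (A x) * norm g" by (rule cmod_cinner_le)
    also have "\<dots> \<le> (norm x * K) * norm g" by (intro mult_right_mono K) simp
    finally show "cmod (cinner (A x) g) \<le> K * norm g * norm x" by (simp add: ac_simps)
  qed
  then show ?thesis by metis
qed

section \<open>Analysis and synthesis operators of a reproducing pair\<close>

lemma frame_op_eqI: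
  assumes "\<And>g. cinner h g = (LINT x|M. cinner f (\<Psi> x) * cinner (\<Phi> x) g)"
  shows "frame_op M \<Psi> \<Phi> f = h"
  unfolding frame_op_def
proof (rule the_equality)
  fix h' assume "\<forall>g. cinner h' g = (LINT x|M. cinner f (\<Psi> x) * cinner (\<Phi> x) g)"
  then show "h' = h" by (intro cinner_left_eqI) (simp add: assms)
qed (simp add: assms)

text \<open>The definition of a reproducing pair speaks only of the frame operator in one order.
  Conjugating its weak integral shows that the Riesz adjoint meets the weak definition of the
  operator in the other order.\<close>

lemma reproducing_pair_frame_op_adjoint:
  fixes \<Psi> \<Phi> :: "'x \<Rightarrow> 'h::chilbert_space"
  assumes "reproducing_pair M \<Psi> \<Phi>"
  shows "cinner (frame_op M \<Psi> \<Phi> f) g = cinner f (frame_op M \<Phi> \<Psi> g)"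
proof -
  have S: "\<And>f g. cinner (frame_op M \<Psi> \<Phi> f) g = (LINT x|M. cinner f (\<Psi> x) * cinner (\<Phi> x) g)"
    and bnd: "bounded_clinear (frame_op M \<Psi> \<Phi>)"
    using assms by (auto simp: reproducing_pair_def)
  obtain A' where A': "\<And>f g. cinner (frame_op M \<Psi> \<Phi> f) g = cinner f (A' g)"
    using bounded_clinear_adjoint_exists[OF bnd] by blast
  have "frame_op M \<Phi> \<Psi> g = A' g"
  proof (rule frame_op_eqI)
    fix k
    have "cinner (A' g) k = cnj (LINT x|M. cinner k (\<Psi> x) * cinner (\<Phi> x) g)"
      by (metis A' S cinner_commute)
    also have "\<dots> = (LINT x|M. cnj (cinner k (\<Psi> x) * cinner (\<Phi> x) g))"
      by (rule Bochner_Integration.integral_cnj[symmetric])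
    also have "\<dots> = (LINT x|M. cinner g (\<Phi> x) * cinner (\<Psi> x) k)"
      by (simp add: cinner_commute[symmetric] mult.commute)
    finally show "cinner (A' g) k = (LINT x|M. cinner g (\<Phi> x) * cinner (\<Psi> x) k)" .
  qed
  then show ?thesis using A' by simp
qed

text \<open>The adjoint \<open>B\<close> of \<open>inv ?S\<close> is a two-sided inverse of the
  adjoint \<open>?S'\<close> of \<open>?S\<close>, which identifies \<open>inv ?S'\<close> with
  \<open>B\<close>.\<close>

lemma reproducing_pair_inv_frame_op_adjoint:
  fixes \<Psi> \<Phi> :: "'x \<Rightarrow> 'h::chilbert_space"
  assumes "reproducing_pair M \<Psi> \<Phi>"
  shows "cinner (inv (frame_op M \<Psi> \<Phi>) f) g = cinner f (inv (frame_op M \<Phi> \<Psi>) g)"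
proof -
  let ?S = "frame_op M \<Psi> \<Phi>" and ?S' = "frame_op M \<Phi> \<Psi>"
  have bij: "bij ?S" and bnd: "bounded_clinear (inv ?S)"
    using assms by (auto simp: reproducing_pair_def)
  have adj: "cinner (?S f) g = cinner f (?S' g)" for f g
    by (rule reproducing_pair_frame_op_adjoint[OF assms])
  have S: "?S (inv ?S f) = f" "inv ?S (?S f) = f" for f
    using bij by (simp_all add: bij_is_surj surj_f_inv_f bij_is_inj inv_f_f)
  obtain B where B: "\<And>f g. cinner (inv ?S f) g = cinner f (B g)"
    using bounded_clinear_adjoint_exists[OF bnd] by blast
  have right_eqI: "x = y" if "\<And>f. cinner f x = cinner f y" for x y :: 'h
    by (rule cinner_left_eqI) (metis that cinner_commute)
  have "B (?S' g) = g" for g by (rule right_eqI) (metis B S(1) adj)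
  moreover have "?S' (B g) = g" for g by (rule right_eqI) (metis B S(2) adj)
  ultimately have "inv ?S' = B"
    by (intro inv_equality) auto
  then show ?thesis using B by simp
qed

section \<open>Linearity of analysis, and synthesis after analysis\<close>

lemma analysis_op_add:
  "analysis_op M \<Psi> (f + g) = (\<lambda>x. analysis_op M \<Psi> f x + analysis_op M \<Psi> g x)"
  by (auto simp: analysis_op_def cinner_add_left)

lemma analysis_op_diff:
  "analysis_op M \<Psi> (f - g) = (\<lambda>x. analysis_op M \<Psi> f x - analysis_op M \<Psi> g x)"
  by (auto simp: analysis_op_def cinner_diff_left)

lemma analysis_op_scaleC: "analysis_op M \<Psi> (c *\<^sub>C f) = (\<lambda>x. c * analysis_op M \<Psi> f x)"
  by (auto simp: analysis_op_def cinner_scaleC_left)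

lemma analysis_op_zero: "analysis_op M \<Psi> 0 = (\<lambda>_. 0)"
  by (auto simp: analysis_op_def)

lemma synthesis_analysis_eq_frame_op:
  fixes \<Psi> \<Phi> :: "'x \<Rightarrow> 'h::chilbert_space"
  assumes "reproducing_pair M \<Psi> \<Phi>"
  shows "synthesis_op M \<Phi> (analysis_op M \<Psi> f) = frame_op M \<Psi> \<Phi> f"
proof -
  let ?S = "frame_op M \<Psi> \<Phi>" and ?F = "analysis_op M \<Psi> f"
  have S: "\<And>g. cinner (?S f) g = (LINT x|M. cinner f (\<Psi> x) * cinner (\<Phi> x) g)"
    and int: "\<And>g. integrable M (\<lambda>x. cinner f (\<Psi> x) * cinner (\<Phi> x) g)"
    and meas: "(\<lambda>x. cinner f (\<Psi> x)) \<in> borel_measurable M"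
    using assms by (auto simp: reproducing_pair_def weakly_measurable_def)
  have int_F: "(LINT x|M. ?F x * cinner (\<Phi> x) g) = (LINT x|M. cinner f (\<Psi> x) * cinner (\<Phi> x) g)" for g
    by (rule Bochner_Integration.integral_cong) (auto simp: analysis_op_def)
  have "?F \<in> synthesis_domain M \<Phi>"
    unfolding synthesis_domain_def mem_Collect_eq
  proof (intro conjI allI impI)
    show "?F \<in> borel_measurable M"
      using meas by (subst measurable_cong[of M ?F "\<lambda>x. cinner f (\<Psi> x)"]) (auto simp: analysis_op_def)
    show "integrable M (\<lambda>x. ?F x * cinner (\<Phi> x) g)" for g
      using int[of g]
      by (subst Bochner_Integration.integrable_cong[where g="\<lambda>x. cinner f (\<Psi> x) * cinner (\<Phi> x) g", OF refl])
         (auto simp: analysis_op_def)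
    \<comment> \<open>The \<open>+ 1\<close> makes the constant strictly positive even if
      \<open>?S f = 0\<close>.\<close>
    have "cmod (LINT x|M. ?F x * cinner (\<Phi> x) g) \<le> (norm (?S f) + 1) * norm g" for g
      using cmod_cinner_le[of "?S f" g] norm_ge_zero[of g] unfolding int_F S[symmetric] distrib_right
      by linarith
    then show "\<exists>B>0. \<forall>g. cmod (LINT x|M. ?F x * cinner (\<Phi> x) g) \<le> B * norm g"
      by (intro exI[of _ "norm (?S f) + 1"]) (auto intro: add_nonneg_pos)
  qed (simp add: analysis_op_def)
  \<comment> \<open>With membership in the domain settled and the integrals identified, both sides
    are the same definite description.\<close>
  then show ?thesis
    by (simp add: synthesis_op_def int_F flip: frame_op_def)
qed

section \<open>Synthesis and negation\<close>

lemma synthesis_domain_uminus: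
  assumes "F \<in> synthesis_domain M \<Phi>"
  shows "(\<lambda>x. - F x) \<in> synthesis_domain M \<Phi>"
  using assms by (auto simp: synthesis_domain_def)

(* Needed for arbitrary F: the locale Metric_space demands symmetry of the distance on the whole
   type, including functions on which synthesis_op has a junk value. *)
lemma synthesis_inner_uminus_self:
  fixes \<Phi> :: "'x \<Rightarrow> 'h::complex_inner"
  shows "synthesis_inner M \<Phi> (\<lambda>x. - F x) (\<lambda>x. - F x) = synthesis_inner M \<Phi> F F"
proof -
  define P where "P F h \<longleftrightarrow> (\<forall>g. cinner h g = (LINT x|M. F x * cinner (\<Phi> x) g))"
    for F and h :: 'h
  have op: "synthesis_op M \<Phi> F = (if F \<in> synthesis_domain M \<Phi> then THE h. P F h else undefined)" for F
    by (simp add: synthesis_op_def P_def)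
  have P_uminus: "P (\<lambda>x. - F x) h \<longleftrightarrow> P F (- h)" for h
    by (auto simp: P_def cinner_minus_left) (metis minus_minus)
  have dom: "(\<lambda>x. - F x) \<in> synthesis_domain M \<Phi> \<longleftrightarrow> F \<in> synthesis_domain M \<Phi>"
    using synthesis_domain_uminus[of F M \<Phi>] synthesis_domain_uminus[of "\<lambda>x. - F x" M \<Phi>] by auto
  have unique: "h = h'" if "P G h" "P G h'" for G h h'
    using that by (intro cinner_left_eqI) (simp add: P_def)
  show ?thesis
  proof (cases "\<exists>h. P F h")
    case True
    then obtain h where h: "P F h" by blast
    then have "P (\<lambda>x. - F x) (- h)" by (simp add: P_uminus)
    with h have "(THE h. P F h) = h" "(THE h. P (\<lambda>x. - F x) h) = - h"
      by (blast intro: the_equality unique)+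
    then show ?thesis
      by (simp add: synthesis_inner_def op dom cinner_minus_left cinner_minus_right)
  next
    case False
    \<comment> \<open>Neither predicate has a solution, so they are equal and the two descriptions
      share one unspecified value.\<close>
    then have "P (\<lambda>x. - F x) = P F"
      by (auto simp: P_uminus)
    then show ?thesis by (simp add: synthesis_inner_def op dom)
  qed
qed

text \<open>A Cauchy sequence lifts through \<open>R\<close> to a Cauchy sequence in the complete
  domain, and \<open>R\<close> carries the limit back.\<close>

lemma (in Metric_space) mcomplete_surjective_isometry:
  fixes R :: "'b::complete_space \<Rightarrow> 'a"
  assumes range: "range R = M" and isometry: "\<And>u v. d (R u) (R v) = dist u v"
  shows mcomplete
  unfolding mcomplete_def
proof (intro allI impI)
  fix \<sigma> assume \<sigma>: "MCauchy \<sigma>"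
  then have "range \<sigma> \<subseteq> range R" by (simp add: MCauchy_def range)
  then have "\<forall>n. \<exists>u. \<sigma> n = R u" by (auto simp: image_iff)
  then obtain u where u: "\<sigma> = (\<lambda>n. R (u n))" by metis
  have "Cauchy u"
    using \<sigma> unfolding MCauchy_def Cauchy_def u isometry by meson
  then obtain v where v: "u \<longlonglongrightarrow> v"
    using Cauchy_convergent_iff convergent_def by blast
  have "limitin mtopology \<sigma> (R v) sequentially"
    using tendsto_dist_iff[THEN iffD1, OF v] range unfolding limitin_metric_dist_null u isometry by auto
  then show "\<exists>l. limitin mtopology \<sigma> l sequentially" by blast
qed

theorem mainTheorem6:
  fixes M :: "'x measure"
    and \<Psi> \<Phi> :: "'x \<Rightarrow> 'h::chilbert_space"
  assumes "sigma_finite_measure M"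
    and "emeasure M (space M) \<noteq> 0"
    and "separable_space (euclidean :: 'h topology)"
    and "reproducing_pair M \<Psi> \<Phi>"
  shows "reproducing_kernel_hilbert_space (space M)
           (range (analysis_op M \<Psi>)) (synthesis_inner M \<Phi>) \<and>
         reproducing_kernel (space M)
           (range (analysis_op M \<Psi>)) (synthesis_inner M \<Phi>) (pair_kernel M \<Psi> \<Phi>)"
proof -
  note pair = assms(4)
  define S where "S = frame_op M \<Psi> \<Phi>"
  define C where "C = analysis_op M \<Psi>"
  define R where "R u = C (inv S u)" for u
  define T' where "T' = inv (frame_op M \<Phi> \<Psi>)"
  define ip where "ip = synthesis_inner M \<Phi>"
  define d where "d F G = sqrt (Re (ip (\<lambda>x. F x - G x) (\<lambda>x. F x - G x)))" for F G
  have bij: "bij S" and inv_S: "bounded_clinear (inv S)"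
    using pair by (auto simp: reproducing_pair_def S_def)
  have S_inv: "S (inv S u) = u" "inv S (S u) = u" for u
    using bij by (simp_all add: bij_is_surj surj_f_inv_f bij_is_inj inv_f_f)
  have adj: "cinner (inv S u) v = cinner u (T' v)" for u v
    unfolding S_def T'_def by (rule reproducing_pair_inv_frame_op_adjoint[OF pair])
  have R_add: "R (u + v) = (\<lambda>x. R u x + R v x)" and R_diff: "R (u - v) = (\<lambda>x. R u x - R v x)"
    and R_scaleC: "R (c *\<^sub>C u) = (\<lambda>x. c * R u x)" and R_zero: "R 0 = (\<lambda>_. 0)" for u v c
    using inv_S linear_add[of "inv S"] linear_diff[of "inv S"] linear_0[of "inv S"]
    by (simp_all add: R_def C_def bounded_clinear_def bounded_linear.linear
        analysis_op_add analysis_op_diff analysis_op_scaleC analysis_op_zero)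
  have range_R: "range R = range C"
    using S_inv by (auto simp: R_def image_iff) metis
  \<comment> \<open>Synthesis undoes \<open>R\<close>: it maps \<open>R u\<close> to
    \<open>S (inv S u) = u\<close>. Every property of \<open>ip\<close> on \<open>range R\<close>
    thus reduces to one of \<open>cinner\<close>.\<close>
  have ip_R: "ip (R u) (R v) = cinner u v" for u v
    using synthesis_analysis_eq_frame_op[OF pair] S_inv(1)
    by (simp add: ip_def synthesis_inner_def R_def C_def S_def)
  have eval: "R u x = cinner u (T' (\<Psi> x))" if "x \<in> space M" for u x
    using that by (simp add: R_def C_def analysis_op_def adj)
  have d_R: "d (R u) (R v) = dist u v" for u v
    by (simp add: d_def ip_R dist_norm norm_eq_sqrt_cinner flip: R_diff)
  \<comment> \<open>If \<open>R u = R v\<close>, then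
    \<open>dist u v = d (R u) (R u) = dist u u = 0\<close>.\<close>
  have inj: "u = v" if "R u = R v" for u v
    using d_R[of u v] d_R[of u u] that by simp
  interpret metric: Metric_space "range R" d
  proof
    fix F G
    show "0 \<le> d F G"
      by (simp add: d_def ip_def synthesis_inner_def cinner_nonneg)
    show "d F G = d G F"
      using synthesis_inner_uminus_self[of M \<Phi> "\<lambda>x. F x - G x"] by (simp add: d_def ip_def)
  qed (auto simp: d_R dist_triangle dest: inj)
  have complete: "metric.mcomplete"
    by (rule metric.mcomplete_surjective_isometry[OF refl d_R])
  have rkhs: "reproducing_kernel_hilbert_space (space M) (range R) ip"
  proof
    fix F G H c x
    show "F x = 0" if "F \<in> range R" "x \<notin> space M"
      using that by (auto simp: R_def C_def analysis_op_def)
    show "(\<lambda>_. 0) \<in> range R" using R_zero by (metis rangeI)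
    show "(\<lambda>x. F x + G x) \<in> range R" if "F \<in> range R" "G \<in> range R"
      using that by (auto simp flip: R_add)
    show "(\<lambda>x. c * F x) \<in> range R" if "F \<in> range R"
      using that by (auto simp flip: R_scaleC)
    show "ip (\<lambda>x. F x + G x) H = ip F H + ip G H" if "F \<in> range R" "G \<in> range R" "H \<in> range R"
      using that by (auto simp: ip_R cinner_add_left simp flip: R_add)
    show "ip (\<lambda>x. c * F x) G = c * ip F G" if "F \<in> range R" "G \<in> range R"
      using that by (auto simp: ip_R cinner_scaleC_left simp flip: R_scaleC)
    show "ip F G = cnj (ip G F)" if "F \<in> range R" "G \<in> range R"
      using that by (auto simp: ip_R simp flip: cinner_commute)
    show "0 \<le> Re (ip F F)" if "F \<in> range R"
      using that by (auto simp: ip_R cinner_nonneg)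
    show "F = (\<lambda>_. 0)" if "F \<in> range R" "ip F F = 0"
      using that by (auto simp: ip_R cinner_eq_zero_iff R_zero)
    show "Metric_space.mcomplete (range R)
        (\<lambda>F G. sqrt (Re (ip (\<lambda>x. F x - G x) (\<lambda>x. F x - G x))))"
      using complete unfolding d_def .
    show "\<exists>B. \<forall>F\<in>range R. cmod (F x) \<le> B * sqrt (Re (ip F F))" if "x \<in> space M"
    proof (intro exI ballI)
      fix F assume "F \<in> range R"
      then obtain u where u: "F = R u" by blast
      \<comment> \<open>The bound is the norm of the vector representing evaluation at
        \<open>x\<close>, by Cauchy-Schwarz.\<close>
      show "cmod (F x) \<le> norm (T' (\<Psi> x)) * sqrt (Re (ip F F))"
        using cmod_cinner_le[of u "T' (\<Psi> x)"]
        by (simp add: u ip_R eval[OF that] mult.commute flip: norm_eq_sqrt_cinner)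
    qed
  qed
  \<comment> \<open>Evaluating \<open>R (T' (\<Psi> x))\<close> at \<open>y\<close> by
    \<open>eval\<close> gives the kernel formula; for \<open>y\<close> outside
    \<open>space M\<close> both sides are \<open>0\<close> by convention.\<close>
  have kernel: "pair_kernel M \<Psi> \<Phi> x = R (T' (\<Psi> x))" if "x \<in> space M" for x
  proof
    fix y
    show "pair_kernel M \<Psi> \<Phi> x y = R (T' (\<Psi> x)) y"
      using that eval[of y "T' (\<Psi> x)"]
      by (cases "y \<in> space M") (simp_all add: pair_kernel_def T'_def R_def C_def analysis_op_def)
  qed
  have "reproducing_kernel (space M) (range R) ip (pair_kernel M \<Psi> \<Phi>)"
    by (auto simp: reproducing_kernel_def kernel ip_R eval)
  with rkhs show ?thesis by (simp add: range_R ip_def C_def)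
qed

end
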